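(* (Energy stability of the characteristic boundary treatment.) On a block face $f$, let $\dot{\boldsymbol{u}}^f$ and $\hat{\boldsymbol{\tau}}^f$ be the face values of the grid particle velocity and the penalized traction, and let the energy face rate of change be $$\dot{\mathcal{E}}^f=(\hat{\boldsymbol{\tau}}^{*f})^T\boldsymbol{H}^f\dot{\boldsymbol{u}}^f+(\hat{\boldsymbol{\tau}}^f)^T\boldsymbol{H}^f\big(\dot{\boldsymbol{u}}^{*f}-\dot{\boldsymbol{u}}^f\big).$$ Suppose the numerical fluxes are the characteristic boundary fluxes with zero boundary data, $$\dot{\boldsymbol{u}}^{*f}=\frac{\boldsymbol{I}+\boldsymbol{R}^f}{2}\Big(\dot{\boldsymbol{u}}^f-(\hat{\boldsymbol{Z}}^f)^{-1}\hat{\boldsymbol{\tau}}^f\Big),\qquad \hat{\boldsymbol{\tau}}^{*f}=-\frac{\boldsymbol{I}-\boldsymbol{R}^f}{2}\Big(\hat{\boldsymbol{Z}}^f\dot{\boldsymbol{u}}^f-\hat{\boldsymbol{\tau}}^f\Big).$$ Then $$\dot{\mathcal{E}}^f=-(\dot{\boldsymbol{u}}^f)^T\frac{\boldsymbol{I}-\boldsymbol{R}^f}{2}\hat{\boldsymbol{Z}}^f\boldsymbol{H}^f\dot{\boldsymbol{u}}^f-(\hat{\boldsymbol{\tau}}^f)^T\frac{\boldsymbol{I}+\boldsymbol{R}^f}{2}(\hat{\boldsymbol{Z}}^f)^{-1}\boldsymbol{H}^f\hat{\boldsymbol{\tau}}^f,$$ and in particular $\dot{\mathcal{E}}^f\le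 0$.
   Context: $\boldsymbol{H}^f$ is the diagonal, positive surface quadrature (norm) matrix of face $f$ of a block of a tensor product summation-by-parts finite difference grid. $\hat{\boldsymbol{Z}}^f$ is the diagonal matrix of the (positive) shear impedance $\hat Z^f$ at the face grid points and $\boldsymbol{R}^f$ the diagonal matrix of reflection coefficients $-1\le R\le1$ at the face grid points; $\boldsymbol{I}$ is the identity. In the scheme, $\boldsymbol{u}^f=\bar{\boldsymbol{L}}^f\tilde{\boldsymbol{u}}$ is the restriction of the grid displacement to the face, $\hat{\boldsymbol{\tau}}^f=\hat{\boldsymbol{T}}^f+\boldsymbol{X}^f(\boldsymbol{u}^{*f}-\boldsymbol{u}^f)$ where $\hat{\boldsymbol{T}}^f$ is the grid approximation of the traction on the face and $\boldsymbol{X}^f$ a positive diagonal penalty matrix, and $\boldsymbol{u}^{*f}$ is an additional face unknown whose time derivative is the given $\dot{\boldsymbol{u}}^{*f}$; the fluxes are the solution of $\hat{\boldsymbol{Z}}^f\dot{\boldsymbol{u}}^{*f}-\hat{\boldsymbol{\tau}}^{*f}=\hat{\boldsymbol{Z}}^f\dot{\boldsymbol{u}}^f-\hat{\boldsymbol{\tau}}^f$ and $\hat{\boldsymbol{Z}}^f\dot{\boldsymbol{u}}^{*f}+\hat{\boldsymbol{\tau}}^{*f}=\boldsymbol{R}^f(\hat{\boldsymbol{Z}}^f\dot{\boldsymbol{u}}^{*f}-\hat{\boldsymbol{\tau}}^{*f})$. The total rate of change of the block energy is the sum of the face rates $\dot{\mathcal{E}}^f$ over the $2d$ faces. *)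

theory Defs
  imports "HOL-Analysis.Analysis"
begin

definition diag_mat :: "real ^ 'n \<Rightarrow> real ^ 'n ^ 'n" where
  "diag_mat d = (\<chi> i j. if i = j then d $ i else 0)"

text \<open>
  Vectors of face grid values are elements of \<open>real ^ 'n\<close>, where the finite type \<open>'n\<close> indexes the
  grid points of the face; \<open>a\<^sup>T H b\<close> is rendered as \<open>a \<bullet> (H *v b)\<close>.
\<close>

definition face_energy_rate ::
  "real ^ 'n ^ 'n \<Rightarrow> real ^ 'n \<Rightarrow> real ^ 'n \<Rightarrow> real ^ 'n \<Rightarrow> real ^ 'n \<Rightarrow> real" where
  "face_energy_rate H v \<tau> vstar \<tau>star = \<tau>star \<bullet> (H *v v) + \<tau> \<bullet> (H *v (vstar - v))"

text \<open>\<open>T\<close> is the grid approximation of the traction on the face.\<close>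

definition penalized_traction ::
  "real ^ 'n ^ 'n \<Rightarrow> real ^ 'n \<Rightarrow> real ^ 'n \<Rightarrow> real ^ 'n \<Rightarrow> real ^ 'n" where
  "penalized_traction X T u ustar = T + X *v (ustar - u)"

text \<open>
  The fluxes solve \<open>Z vstar - \<tau>star = Z v - \<tau>\<close> and
  \<open>Z vstar + \<tau>star = R (Z vstar - \<tau>star)\<close>, i.e. the boundary data are zero.
\<close>

definition char_velocity_flux ::
  "real ^ 'n ^ 'n \<Rightarrow> real ^ 'n ^ 'n \<Rightarrow> real ^ 'n \<Rightarrow> real ^ 'n \<Rightarrow> real ^ 'n" where
  "char_velocity_flux Z R v \<tau> = ((1/2) *\<^sub>R (mat 1 + R)) *v (v - matrix_inv Z *v \<tau>)"

definition char_traction_flux ::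
  "real ^ 'n ^ 'n \<Rightarrow> real ^ 'n ^ 'n \<Rightarrow> real ^ 'n \<Rightarrow> real ^ 'n \<Rightarrow> real ^ 'n" where
  "char_traction_flux Z R v \<tau> = - (((1/2) *\<^sub>R (mat 1 - R)) *v (Z *v v - \<tau>))"

end

theory Submission
  imports Defs
begin

text \<open>
  All matrices involved are diagonal, so the energy rate decouples into scalar contributions, one
  per face grid point. At a grid point both fluxes are multiples of the single characteristic
  variable \<open>z v - \<tau>\<close>: it is split between \<open>z vstar\<close> and \<open>- \<tau>star\<close> with weights \<open>(1 + r)/2\<close> and
  \<open>(1 - r)/2\<close>. These weights sum to one, and that is exactly what makes the indefinite cross term
  \<open>v \<tau>\<close> cancel, leaving only two negative squares (\<open>pointwise_energy_rate\<close>). The same weights are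
  nonnegative because \<open>-1 \<le> r \<le> 1\<close>, so the rate is nonpositive.

  The matrix side of the argument is the algebra of diagonal matrices: products, inverses and the
  factors \<open>(I \<plusminus> R)/2\<close> are again diagonal and are computed entrywise, and a diagonal bilinear form
  is a weighted sum (\<open>inner_diag_mat\<close>).
\<close>

lemma diag_mat_mult_vec: "diag_mat d *v a = (\<chi> i. d $ i * a $ i)"
  by (simp add: diag_mat_def matrix_vector_mult_def vec_eq_iff if_distrib[where f="\<lambda>c. c * _"]
      cong: if_cong)

lemma diag_mat_mult: "diag_mat c ** diag_mat d = diag_mat (\<chi> i. c $ i * d $ i)"
  by (simp add: matrix_eq matrix_vector_mul_assoc[symmetric] diag_mat_mult_vec mult.assoc)

lemma matrix_inv_unique:
  fixes A :: "'a::semiring_1 ^ 'n ^ 'm"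
  assumes AB: "A ** B = mat 1" and BA: "B ** A = mat 1"
  shows "matrix_inv A = B"
proof -
  have "A ** matrix_inv A = mat 1 \<and> matrix_inv A ** A = mat 1"
    unfolding matrix_inv_def by (rule someI[of _ B]) (use assms in simp)
  then have "B ** (A ** matrix_inv A) = B"
    by simp
  then show ?thesis
    by (simp add: matrix_mul_assoc BA)
qed

lemma matrix_inv_diag_mat:
  assumes "\<And>i. d $ i \<noteq> 0"
  shows "matrix_inv (diag_mat d) = diag_mat (\<chi> i. inverse (d $ i))"
  by (rule matrix_inv_unique; unfold diag_mat_mult)
    (use assms in \<open>simp_all add: diag_mat_def mat_def vec_eq_iff\<close>)

lemma half_mat_1_plus_diag_mat:
  "(1/2) *\<^sub>R (mat 1 + diag_mat r) = diag_mat (\<chi> i. (1 + r $ i) / 2)"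
  by (simp add: diag_mat_def mat_def vec_eq_iff)

lemma half_mat_1_minus_diag_mat:
  "(1/2) *\<^sub>R (mat 1 - diag_mat r) = diag_mat (\<chi> i. (1 - r $ i) / 2)"
  by (simp add: diag_mat_def mat_def vec_eq_iff)

lemma inner_diag_mat: "a \<bullet> (diag_mat d *v b) = (\<Sum>i\<in>UNIV. d $ i * a $ i * b $ i)"
  by (simp add: inner_vec_def diag_mat_mult_vec mult_ac)

text \<open>
  The coefficient of \<open>h v \<tau>\<close> on the left is \<open>(1 - r)/2\<close> from the traction flux, \<open>(1 + r)/2\<close> from
  the velocity flux and \<open>-1\<close> from the jump, in total zero.
\<close>
lemma pointwise_energy_rate:
  fixes h z r v \<tau> :: real
  assumes "z \<noteq> 0"
  shows "h * (- ((1 - r) / 2 * (z * v - \<tau>))) * v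
           + h * \<tau> * ((1 + r) / 2 * (v - inverse z * \<tau>) - v)
         = - ((1 - r) / 2 * z * h * v * v) - (1 + r) / 2 * inverse z * h * \<tau> * \<tau>"
  using assms by (simp add: field_simps)

lemma diag_form_nonneg:
  assumes "\<And>i. 0 \<le> d $ i"
  shows "0 \<le> a \<bullet> (diag_mat d *v a)"
  using assms by (simp add: inner_diag_mat mult.assoc sum_nonneg)

theorem mainTheorem5:
  fixes h z r x :: "real ^ 'n"
    and H Z R X :: "real ^ 'n ^ 'n"
    and L :: "real ^ 'g ^ 'n"
    and That :: "real ^ 'g \<Rightarrow> real ^ 'n"
    and u :: "real \<Rightarrow> real ^ 'g"
    and ustar :: "real \<Rightarrow> real ^ 'n"
    and v :: "real ^ 'g"
    and vf \<tau>f vstar \<tau>star :: "real ^ 'n"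
    and J :: "real set" and t :: real
  assumes H: "H = diag_mat h" "\<And>i. h $ i > 0"
    and Z: "Z = diag_mat z" "\<And>i. z $ i > 0"
    and R: "R = diag_mat r" "\<And>i. - 1 \<le> r $ i" "\<And>i. r $ i \<le> 1"
    and X: "X = diag_mat x" "\<And>i. x $ i > 0"
    and t: "t \<in> J"
    and grid_velocity: "(u has_vector_derivative v) (at t within J)"
    and face_velocity: "vf = L *v v"
    and traction: "\<tau>f = penalized_traction X (That (u t)) (L *v u t) (ustar t)"
    and ustar: "(ustar has_vector_derivative vstar) (at t within J)"
    and velocity_flux: "vstar = char_velocity_flux Z R vf \<tau>f"
    and traction_flux: "\<tau>star = char_traction_flux Z R vf \<tau>f"
  shows "face_energy_rate H vf \<tau>f vstar \<tau>star =
           - (vf \<bullet> ((((1/2) *\<^sub>R (mat 1 - R)) ** Z ** H) *v vf))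
           - \<tau>f \<bullet> ((((1/2) *\<^sub>R (mat 1 + R)) ** matrix_inv Z ** H) *v \<tau>f)
         \<and> face_energy_rate H vf \<tau>f vstar \<tau>star \<le> 0"
proof -
  have inv: "matrix_inv Z = diag_mat (\<chi> i. inverse (z $ i))"
    unfolding Z(1) by (rule matrix_inv_diag_mat) (simp add: Z(2) less_imp_neq[symmetric])
  have damp_v: "((1/2) *\<^sub>R (mat 1 - R)) ** Z ** H = diag_mat (\<chi> i. (1 - r $ i) / 2 * z $ i * h $ i)"
    unfolding H(1) Z(1) R(1) half_mat_1_minus_diag_mat by (simp add: diag_mat_mult)
  have damp_\<tau>: "((1/2) *\<^sub>R (mat 1 + R)) ** matrix_inv Z ** H
      = diag_mat (\<chi> i. (1 + r $ i) / 2 * inverse (z $ i) * h $ i)"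
    unfolding inv H(1) R(1) half_mat_1_plus_diag_mat by (simp add: diag_mat_mult)
  have vstar_i: "vstar $ i = (1 + r $ i) / 2 * (vf $ i - inverse (z $ i) * \<tau>f $ i)" for i
    unfolding velocity_flux char_velocity_flux_def inv R(1) half_mat_1_plus_diag_mat
    by (simp add: diag_mat_mult_vec)
  have \<tau>star_i: "\<tau>star $ i = - ((1 - r $ i) / 2 * (z $ i * vf $ i - \<tau>f $ i))" for i
    unfolding traction_flux char_traction_flux_def Z(1) R(1) half_mat_1_minus_diag_mat
    by (simp add: diag_mat_mult_vec)
  have "face_energy_rate H vf \<tau>f vstar \<tau>star
      = (\<Sum>i\<in>UNIV. h $ i * \<tau>star $ i * vf $ i + h $ i * \<tau>f $ i * (vstar $ i - vf $ i))"
    by (simp add: face_energy_rate_def H(1) inner_diag_mat sum.distrib)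
  also have "\<dots> = (\<Sum>i\<in>UNIV. - ((1 - r $ i) / 2 * z $ i * h $ i * vf $ i * vf $ i)
      - (1 + r $ i) / 2 * inverse (z $ i) * h $ i * \<tau>f $ i * \<tau>f $ i)"
    unfolding vstar_i \<tau>star_i
    by (intro sum.cong refl pointwise_energy_rate) (simp add: Z(2) less_imp_neq[symmetric])
  also have "\<dots> = - (vf \<bullet> ((((1/2) *\<^sub>R (mat 1 - R)) ** Z ** H) *v vf))
      - \<tau>f \<bullet> ((((1/2) *\<^sub>R (mat 1 + R)) ** matrix_inv Z ** H) *v \<tau>f)"
    unfolding damp_v damp_\<tau> by (simp add: inner_diag_mat sum_subtractf sum_negf)
  finally have identity: "face_energy_rate H vf \<tau>f vstar \<tau>star = \<dots>" .
  have "0 \<le> (1 - r $ i) / 2 * z $ i * h $ i" for i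
    using H(2)[of i] Z(2)[of i] R(3)[of i] by simp
  then have "0 \<le> vf \<bullet> ((((1/2) *\<^sub>R (mat 1 - R)) ** Z ** H) *v vf)"
    unfolding damp_v by (intro diag_form_nonneg) simp
  moreover have "0 \<le> (1 + r $ i) / 2 * inverse (z $ i) * h $ i" for i
    using H(2)[of i] Z(2)[of i] R(2)[of i] by simp
  then have "0 \<le> \<tau>f \<bullet> ((((1/2) *\<^sub>R (mat 1 + R)) ** matrix_inv Z ** H) *v \<tau>f)"
    unfolding damp_\<tau> by (intro diag_form_nonneg) simp
  ultimately show ?thesis
    using identity by simp
qed

end
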